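(* Suppose Assumptions 1 and 2 (listed in the context) hold. Let $\{x^k\}$ be generated by the VBPG method, let $\bar{x}$ be an accumulation point of $\{x^k\}$, $\bar F=F(\bar x)$, and let $\nu>0$. Put $\mathfrak{b}=\frac{M}{\underline{\epsilon}}+2+3L$ and $\mathfrak{c}=\frac{m}{\overline{\epsilon}}-(L+2)$. (i) For any initial point $x^0\in[\bar F<F<\bar F+\nu]$, if the strong level-set Bregman proximal error bound holds on $[\bar F<F<\bar F+\nu]$ with constant $\theta'\in\left(\sqrt{\frac{\mathfrak{c}}{\mathfrak{b}}},\sqrt{\frac{\mathfrak{c}}{\mathfrak{b}-1}}\right)$, then the VBPG method converges linearly with respect to the level set $[F\le\bar F]$, i.e. $$\mathrm{dist}\left(x^{k+1},[F\le\bar F]\right)\le\beta\,\mathrm{dist}\left(x^k,[F\le\bar F]\right)\qquad\forall k\ge0,\qquad( * )$$ with $\beta:=\sqrt{\mathfrak{b}-\frac{\mathfrak{c}}{(\theta')^2}}\in(0,1)$. (ii) If $g$ is semi-convex on $\mathbb{R}^n$ with modulus $\rho>0$, $\overline{\epsilon}<\min\{\frac{m}{L},\frac{m}{\rho}\}$, and the VBPG method converges linearly in the sense of $( * )$, for any initial point $x^0\in[\bar F<F<\bar F+\nu]$, with some $\beta\in(0,1)$, then $F$ satisfies the strong level-set subdifferential error bound on $[\bar F<F<\bar F+\nu]$ with constant $c_1'=\frac{\overline{\epsilon}}{(1-\beta)(m-\overline{\epsilon}\rho)}\sqrt{\frac{\overline{\epsilon}}{\underline{\epsilon}}}$, and the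 strong level-set Bregman proximal error bound on $[\bar F<F<\bar F+\nu]$ with constant $\theta'=1+c_1'\left(L+\frac{M}{\underline{\epsilon}}\right)$.
   Context: $\langle\cdot,\cdot\rangle,\|\cdot\|$ are the Euclidean inner product and norm on $\mathbb{R}^n$; $\mathrm{dist}(x,C)=\inf_{z\in C}\|x-z\|$, $\mathrm{dist}(x,\emptyset)=\infty$. $F=f+g$, $[F\le\bar F]=\{x:F(x)\le\bar F\}$, $[\bar F<F<\bar F+\nu]=\{x:\bar F<F(x)<\bar F+\nu\}$. Assumption 1: (i) $f:\mathbb{R}^n\to(-\infty,\infty]$ is proper lower semicontinuous (l.s.c.), differentiable on $\mathrm{dom} f$, $\mathrm{dom} f$ is convex, and $\nabla f$ is $L$-Lipschitz ($L>0$); (ii) $g:\mathbb{R}^n\to(-\infty,\infty]$ is proper l.s.c. and $\mathrm{dom}\,g$ is convex; (iii) $F$ is level-bounded: $\{x: F(x)\le r\}$ is bounded (possibly empty) for every $r\in\mathbb{R}$. Assumption 2: for each $k\in\mathbb{N}$, $K^k:\mathbb{R}^n\to\mathbb{R}$ is differentiable, strongly convex with uniform modulus $m>0$, and $\nabla K^k$ is uniformly $M$-Lipschitz; $0<\underline{\epsilon}\le\epsilon^k\le\overline{\epsilon}$ for all $k$. Bregman distances: $D^k(x,y)=K^k(y)-[K^k(x)+\langle\nabla K^k(x),y-x\rangle]$. For a Bregman distance $D$ and $\epsilon>0$, $T_{D,\epsilon}(x)=\operatorname{argmin}_{y}\{\langle\nabla f(x),y-x\rangle+g(y)+\frac1\epsilon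 D(x,y)\}$ (a set), for $x\in\mathbb{R}^n$; since it is defined for every $x\in\mathbb{R}^n$, $f$ is understood to be finite and differentiable on $\mathbb{R}^n$ when it is used. VBPG method: from an initial point $x^0$, $x^{k+1}\in T_{D^k,\epsilon^k}(x^k)$ for all $k\ge0$. Strong level-set subdifferential error bound on $[\bar F<F<\bar F+\nu]$ with constant $c_1'>0$: $\mathrm{dist}(x,[F\le\bar F])\le c_1'\,\mathrm{dist}(0,\partial_PF(x))$ for all $x\in[\bar F<F<\bar F+\nu]$. Strong level-set Bregman proximal error bound on $[\bar F<F<\bar F+\nu]$ with constant $\theta'>0$: $\mathrm{dist}(x,[F\le\bar F])\le\theta'\,\mathrm{dist}(x,T_{D,\epsilon}(x))$ for all $x\in[\bar F<F<\bar F+\nu]$; here it is understood for every pair $(D,\epsilon)=(D^k,\epsilon^k)$, $k\ge0$, with the same $\theta'$. A l.s.c. function $\psi$ is semi-convex with modulus $\rho>0$ if there is a convex function $h:\mathbb{R}^n\to\mathbb{R}$ with $\psi(x)=h(x)-\frac{\rho}{2}\|x\|^2$ on $\mathrm{dom}\,\psi$. Proximal subdifferential: for $\bar x\in\mathrm{dom}\,\psi$, $\partial_P\psi(\bar x)$ is the set of $\xi$ for which there are $\rho'>0,\delta>0$ with $\psi(x)\ge\psi(\bar x)+\langle\xi,x-\bar x\rangle-\rho'\|x-\bar x\|^2$ whenever $\|x-\bar x\|<\delta$. *)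

theory Defs
  imports "HOL-Analysis.Analysis"
begin

text \<open>Extended-real-valued functions with values in \<open>(-\<infinity>, \<infinity>]\<close> are rendered as functions into
  \<^typ>\<open>ereal\<close>; that \<open>-\<infinity>\<close> is never attained is part of properness.\<close>

definition effdom :: "('a \<Rightarrow> ereal) \<Rightarrow> 'a set" where
  "effdom \<psi> = {x. \<psi> x < \<infinity>}"

definition proper_fun :: "('a \<Rightarrow> ereal) \<Rightarrow> bool" where
  "proper_fun \<psi> \<longleftrightarrow> (\<forall>x. \<psi> x \<noteq> -\<infinity>) \<and> effdom \<psi> \<noteq> {}"

definition lsc :: "('a::topological_space \<Rightarrow> ereal) \<Rightarrow> bool" where
  "lsc \<psi> \<longleftrightarrow> (\<forall>x. \<psi> x \<le> Liminf (at x) \<psi>)"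

definition level_bounded :: "('a::metric_space \<Rightarrow> ereal) \<Rightarrow> bool" where
  "level_bounded \<psi> \<longleftrightarrow> (\<forall>r::real. bounded {x. \<psi> x \<le> ereal r})"

text \<open>The library's \<^const>\<open>infdist\<close> is \<open>0\<close> for the empty set; here the infimum is taken in
  \<^typ>\<open>ereal\<close>, so that the distance to the empty set is \<open>\<infinity>\<close>.\<close>

definition edist :: "'a::real_normed_vector \<Rightarrow> 'a set \<Rightarrow> ereal" where
  "edist x C = (INF z\<in>C. ereal (norm (x - z)))"

definition grad :: "('a::real_inner \<Rightarrow> real) \<Rightarrow> 'a \<Rightarrow> 'a" where
  "grad h x = (THE d. GDERIV h x :> d)"

definition objective :: "('a \<Rightarrow> ereal) \<Rightarrow> ('a \<Rightarrow> ereal) \<Rightarrow> 'a \<Rightarrow> ereal" where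
  "objective f g x = f x + g x"

definition level_le :: "('a \<Rightarrow> ereal) \<Rightarrow> ereal \<Rightarrow> 'a set" where
  "level_le F Fbar = {x. F x \<le> Fbar}"

definition band :: "('a \<Rightarrow> ereal) \<Rightarrow> ereal \<Rightarrow> real \<Rightarrow> 'a set" where
  "band F Fbar \<nu> = {x. Fbar < F x \<and> F x < Fbar + ereal \<nu>}"

definition assumption1 :: "(real^'n \<Rightarrow> ereal) \<Rightarrow> (real^'n \<Rightarrow> ereal) \<Rightarrow> real \<Rightarrow> bool" where
  "assumption1 f g L \<longleftrightarrow>
     proper_fun f \<and> lsc f \<and> convex (effdom f) \<and>
     (\<lambda>x. real_of_ereal (f x)) differentiable_on effdom f \<and>
     L > 0 \<and> L-lipschitz_on (effdom f) (grad (\<lambda>x. real_of_ereal (f x))) \<and>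
     proper_fun g \<and> lsc g \<and> convex (effdom g) \<and>
     level_bounded (objective f g)"

definition strongly_convex :: "real \<Rightarrow> ('a::real_normed_vector \<Rightarrow> real) \<Rightarrow> bool" where
  "strongly_convex m h \<longleftrightarrow>
     (\<forall>x y t. 0 \<le> t \<and> t \<le> 1 \<longrightarrow>
        h ((1 - t) *\<^sub>R x + t *\<^sub>R y)
          \<le> (1 - t) * h x + t * h y - m / 2 * t * (1 - t) * (norm (x - y))\<^sup>2)"

definition assumption2 ::
  "(nat \<Rightarrow> real^'n \<Rightarrow> real) \<Rightarrow> (nat \<Rightarrow> real) \<Rightarrow> real \<Rightarrow> real \<Rightarrow> real \<Rightarrow> real \<Rightarrow> bool" where
  "assumption2 K \<epsilon> m M \<epsilon>l \<epsilon>u \<longleftrightarrow>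
     m > 0 \<and>
     (\<forall>k. K k differentiable_on UNIV \<and> strongly_convex m (K k) \<and>
          M-lipschitz_on UNIV (grad (K k))) \<and>
     0 < \<epsilon>l \<and> (\<forall>k. \<epsilon>l \<le> \<epsilon> k \<and> \<epsilon> k \<le> \<epsilon>u)"

definition bregman :: "('a::real_inner \<Rightarrow> real) \<Rightarrow> 'a \<Rightarrow> 'a \<Rightarrow> real" where
  "bregman K x y = K y - (K x + inner (grad K x) (y - x))"

text \<open>The Bregman proximal mapping, a set of minimizers. It is only used when \<open>f\<close> is finite
  everywhere, so that \<^const>\<open>real_of_ereal\<close> loses nothing.\<close>

definition prox_map ::
  "('a::real_inner \<Rightarrow> ereal) \<Rightarrow> ('a \<Rightarrow> ereal) \<Rightarrow> ('a \<Rightarrow> 'a \<Rightarrow> real) \<Rightarrow> real \<Rightarrow> 'a \<Rightarrow> 'a set" where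
  "prox_map f g D e x =
     {z. is_arg_min
           (\<lambda>y. ereal (inner (grad (\<lambda>u. real_of_ereal (f u)) x) (y - x)) + g y
                  + ereal (1 / e * D x y))
           (\<lambda>_. True) z}"

definition vbpg ::
  "('a::real_inner \<Rightarrow> ereal) \<Rightarrow> ('a \<Rightarrow> ereal) \<Rightarrow> (nat \<Rightarrow> 'a \<Rightarrow> real) \<Rightarrow> (nat \<Rightarrow> real) \<Rightarrow> (nat \<Rightarrow> 'a) \<Rightarrow> bool"
  where
  "vbpg f g K \<epsilon> x \<longleftrightarrow> (\<forall>k. x (Suc k) \<in> prox_map f g (bregman (K k)) (\<epsilon> k) (x k))"

definition accumulation_point :: "(nat \<Rightarrow> 'a::topological_space) \<Rightarrow> 'a \<Rightarrow> bool" where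
  "accumulation_point x p \<longleftrightarrow> (\<exists>r::nat \<Rightarrow> nat. strict_mono r \<and> (x \<circ> r) \<longlonglongrightarrow> p)"

definition prox_subdiff :: "('a::real_inner \<Rightarrow> ereal) \<Rightarrow> 'a \<Rightarrow> 'a set" where
  "prox_subdiff \<psi> p =
     {\<xi>. p \<in> effdom \<psi> \<and>
         (\<exists>\<rho>>0. \<exists>\<delta>>0. \<forall>x. norm (x - p) < \<delta> \<longrightarrow>
            \<psi> x \<ge> \<psi> p + ereal (inner \<xi> (x - p)) - ereal (\<rho> * (norm (x - p))\<^sup>2))}"

definition semi_convex :: "real \<Rightarrow> ('a::real_inner \<Rightarrow> ereal) \<Rightarrow> bool" where
  "semi_convex \<rho> \<psi> \<longleftrightarrow> lsc \<psi> \<and> \<rho> > 0 \<and>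
     (\<exists>h::'a \<Rightarrow> real. convex_on UNIV h \<and>
        (\<forall>x\<in>effdom \<psi>. \<psi> x = ereal (h x - \<rho> / 2 * (norm x)\<^sup>2)))"

definition strong_subdiff_EB ::
  "('a::real_inner \<Rightarrow> ereal) \<Rightarrow> ereal \<Rightarrow> real \<Rightarrow> real \<Rightarrow> bool" where
  "strong_subdiff_EB F Fbar \<nu> c \<longleftrightarrow> c > 0 \<and>
     (\<forall>x\<in>band F Fbar \<nu>. edist x (level_le F Fbar) \<le> ereal c * edist 0 (prox_subdiff F x))"

text \<open>The bound is required for every pair \<open>(D\<^sup>k, \<epsilon>\<^sup>k)\<close>, with one common constant.\<close>

definition strong_bregman_EB ::
  "('a::real_inner \<Rightarrow> ereal) \<Rightarrow> ('a \<Rightarrow> ereal) \<Rightarrow> (nat \<Rightarrow> 'a \<Rightarrow> real) \<Rightarrow> (nat \<Rightarrow> real)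
     \<Rightarrow> ereal \<Rightarrow> real \<Rightarrow> real \<Rightarrow> bool" where
  "strong_bregman_EB f g K \<epsilon> Fbar \<nu> \<theta> \<longleftrightarrow> \<theta> > 0 \<and>
     (\<forall>k. \<forall>x\<in>band (objective f g) Fbar \<nu>.
        edist x (level_le (objective f g) Fbar)
          \<le> ereal \<theta> * edist x (prox_map f g (bregman (K k)) (\<epsilon> k) x))"

definition level_linear_conv ::
  "('a::real_normed_vector \<Rightarrow> ereal) \<Rightarrow> ereal \<Rightarrow> real \<Rightarrow> (nat \<Rightarrow> 'a) \<Rightarrow> bool" where
  "level_linear_conv F Fbar \<beta> x \<longleftrightarrow>
     (\<forall>k. edist (x (Suc k)) (level_le F Fbar) \<le> ereal \<beta> * edist (x k) (level_le F Fbar))"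

end

theory Submission
  imports Defs
begin

text \<open>For \<open>z \<in> T(x)\<close> and any \<open>p\<close>, comparing \<open>z\<close> with \<open>p\<close> in the proximal subproblem and using the
  descent lemma for \<open>f\<close> and \<open>K\<close> gives
  \<open>F(z) + (m/\<epsilon> - L)/2 |z - x|\<^sup>2 \<le> F(p) + (M/\<epsilon> + L)/2 |p - x|\<^sup>2\<close>.
  With \<open>p = x\<close> this is descent. With \<open>p\<close> the projection of \<open>x\<close> onto the level set and \<open>F(p) \<le> F(z)\<close>,
  adding \<open>|z - p|\<^sup>2 \<le> 2|z - x|\<^sup>2 + 2|p - x|\<^sup>2\<close> and bounding \<open>|z - x|\<close> from below by the proximal
  error bound yields the linear rate.

  Conversely, one contracting step from \<open>x\<close> gives \<open>(1 - \<beta>) dist(x, C) \<le> |x - z|\<close>, and for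
  semi-convex \<open>g\<close> the strong convexity of the subproblem gives \<open>(m/\<epsilon> - \<rho>) |x - z| \<le> |\<xi>|\<close> for each
  \<open>\<xi> \<in> \<partial>\<^sub>P F(x)\<close>. The proximal error bound follows because the optimality condition at \<open>z\<close> exhibits
  an element of \<open>\<partial>\<^sub>P F(z)\<close> of norm at most \<open>(L + M/\<epsilon>) |x - z|\<close>.\<close>

section \<open>Gradients, descent lemma and strong convexity\<close>

lemma gderiv_grad:
  fixes h :: "'a::euclidean_space \<Rightarrow> real"
  assumes "h differentiable at x"
  shows "GDERIV h x :> grad h x"
proof -
  obtain h' where h': "(h has_derivative h') (at x)"
    using assms by (auto simp: differentiable_def)
  \<comment> \<open>Riesz representation: \<open>adjoint h' 1\<close> is the vector representing the
    functional \<open>h'\<close>. Its uniqueness is what makes the definite description in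
    \<open>grad\<close> meaningful.\<close>
  have "h' = (\<lambda>u. inner u (adjoint h' 1))"
    using adjoint_works[OF has_derivative_linear[OF h']] by (auto simp: inner_real_def)
  then have ex: "GDERIV h x :> adjoint h' 1"
    using h' by (simp add: gderiv_def)
  moreover have "d = adjoint h' 1" if "GDERIV h x :> d" for d
  proof -
    have "(\<lambda>u. inner u d) = (\<lambda>u. inner u (adjoint h' 1))"
      using that ex unfolding gderiv_def by (rule has_derivative_unique)
    then show ?thesis
      by (metis vector_eq_ldot)
  qed
  ultimately show ?thesis
    unfolding grad_def by (rule theI)
qed

text \<open>Along the segment from \<open>x\<close> to \<open>y\<close>, the auxiliary
  \<open>\<phi>\<close> is \<open>h\<close> minus the linear and quadratic terms of the bound.
  Cauchy-Schwarz and the Lipschitz condition make its derivative nonpositive, and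
  \<open>\<phi> 1 \<le> \<phi> 0\<close> is the claim.\<close>

lemma descent_upper:
  fixes h :: "'a::real_inner \<Rightarrow> real"
  assumes G: "\<And>x. GDERIV h x :> G x" and lip: "L-lipschitz_on UNIV G"
  shows "h y \<le> h x + inner (G x) (y - x) + L / 2 * (norm (y - x))\<^sup>2"
proof -
  define v where "v = y - x"
  define \<phi> where "\<phi> t = h (x + t *\<^sub>R v) - t * inner (G x) v - L / 2 * t\<^sup>2 * (norm v)\<^sup>2" for t
  have "((\<lambda>t. h (x + t *\<^sub>R v)) has_derivative (\<lambda>s. inner (s *\<^sub>R v) (G (x + t *\<^sub>R v)))) (at t)" for t
    by (rule has_derivative_compose[OF _ G[unfolded gderiv_def]]) (auto intro!: derivative_eq_intros)
  then have "((\<lambda>t. h (x + t *\<^sub>R v)) has_real_derivative inner v (G (x + t *\<^sub>R v))) (at t)" for t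
    by (simp add: has_field_derivative_def mult.commute[of _ "inner _ _"])
  then have deriv: "(\<phi> has_real_derivative
      (inner v (G (x + t *\<^sub>R v)) - inner (G x) v - L * t * (norm v)\<^sup>2)) (at t)" for t
    unfolding \<phi>_def by (auto intro!: derivative_eq_intros)
  have "inner v (G (x + t *\<^sub>R v)) - inner (G x) v - L * t * (norm v)\<^sup>2 \<le> 0" if "0 \<le> t" for t
  proof -
    have "inner v (G (x + t *\<^sub>R v)) - inner (G x) v = inner v (G (x + t *\<^sub>R v) - G x)"
      by (simp add: inner_diff_right inner_commute)
    also have "\<dots> \<le> norm v * norm (G (x + t *\<^sub>R v) - G x)"
      by (rule norm_cauchy_schwarz)
    also have "\<dots> \<le> norm v * (L * (t * norm v))"
      using lipschitz_onD[OF lip, of "x + t *\<^sub>R v" x] that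
      by (intro mult_left_mono) (auto simp: dist_norm)
    finally show ?thesis
      by (simp add: power2_eq_square mult.assoc mult.left_commute)
  qed
  with deriv have "\<exists>y. (\<phi> has_real_derivative y) (at t) \<and> y \<le> 0" if "0 \<le> t" for t
    using that by (intro exI conjI)
  then have "\<phi> 1 \<le> \<phi> 0"
    by (intro DERIV_nonpos_imp_nonincreasing[of 0 1 \<phi>]) auto
  then show ?thesis
    by (simp add: \<phi>_def v_def)
qed

lemma descent_lower:
  fixes h :: "'a::real_inner \<Rightarrow> real"
  assumes G: "\<And>x. GDERIV h x :> G x" and lip: "L-lipschitz_on UNIV G"
  shows "h x + inner (G x) (y - x) - L / 2 * (norm (y - x))\<^sup>2 \<le> h y"
  using descent_upper[OF GDERIV_minus[OF G] lipschitz_on_minus[OF lip], of y x] by simp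

text \<open>Divide by \<open>t\<close> and let \<open>t\<close> tend to 0 from the right. This turns
  a comparison along a short segment, with an error of second order, into a first-order
  inequality.\<close>

lemma nonpos_if_mult_le_square:
  fixes a b \<delta> :: real
  assumes "0 < \<delta>" and le: "\<And>t. 0 < t \<Longrightarrow> t < \<delta> \<Longrightarrow> t * a \<le> t\<^sup>2 * b"
  shows "a \<le> 0"
proof -
  have "((\<lambda>t. t * b) \<longlongrightarrow> 0 * b) (at_right 0)"
    by (intro tendsto_intros)
  moreover have "\<forall>\<^sub>F t in at_right 0. a \<le> t * b"
    unfolding eventually_at_right_field
    using assms by (intro exI[of _ \<delta>]) (auto simp: power2_eq_square mult.assoc)
  ultimately show ?thesis
    by (intro tendsto_lowerbound) auto
qed

lemma strongly_convex_lower: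
  fixes h :: "'a::real_inner \<Rightarrow> real"
  assumes sc: "strongly_convex m h" and G: "\<And>x. GDERIV h x :> G x" and lip: "M-lipschitz_on UNIV G"
  shows "h x + inner (G x) (y - x) + m / 2 * (norm (y - x))\<^sup>2 \<le> h y"
proof -
  let ?n = "(norm (y - x))\<^sup>2"
  \<comment> \<open>Both errors are of order \<open>t\<^sup>2\<close>: \<open>M / 2\<close> comes
    from \<open>descent_lower\<close> at the intermediate point, \<open>m / 2\<close> from writing
    \<open>t * (1 - t)\<close> as \<open>t - t\<^sup>2\<close>.\<close>
  have "h x + inner (G x) (y - x) + m / 2 * ?n - h y \<le> 0"
  proof (rule nonpos_if_mult_le_square[of 1 _ "(m + M) / 2 * ?n"])
    fix t :: real assume t: "0 < t" "t < 1"
    have eq: "(1 - t) *\<^sub>R x + t *\<^sub>R y = x + t *\<^sub>R (y - x)"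
      by (simp add: algebra_simps)
    have "h x + t * inner (G x) (y - x) - M / 2 * (t\<^sup>2 * ?n) \<le> h (x + t *\<^sub>R (y - x))"
      using descent_lower[OF G lip, of x "x + t *\<^sub>R (y - x)"] by (simp add: power_mult_distrib)
    also have "\<dots> \<le> (1 - t) * h x + t * h y - m / 2 * t * (1 - t) * ?n"
      using sc[unfolded strongly_convex_def, rule_format, of t x y] t
      by (simp add: eq norm_minus_commute)
    finally show "t * (h x + inner (G x) (y - x) + m / 2 * ?n - h y) \<le> t\<^sup>2 * ((m + M) / 2 * ?n)"
      by (simp add: field_simps power2_eq_square)
  qed simp
  then show ?thesis by simp
qed

section \<open>Closed sublevel sets of lower semicontinuous functions\<close>

lemma lsc_closed_sublevel:
  assumes "lsc \<psi>"
  shows "closed {x. \<psi> x \<le> c}"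
proof -
  have "\<forall>\<^sub>F y in nhds x. c < \<psi> y" if "c < \<psi> x" for x
  proof -
    have "c < Liminf (at x) \<psi>"
      using that assms unfolding lsc_def by (blast intro: less_le_trans)
    \<comment> \<open>The filter \<open>at x\<close> leaves out \<open>x\<close> itself; there the
      inequality is the assumption on \<open>\<psi> x\<close>.\<close>
    then have "\<forall>\<^sub>F y in nhds x. y \<noteq> x \<longrightarrow> c < \<psi> y"
      using less_LiminfD[of c "at x" \<psi>] by (simp add: eventually_at_filter)
    then show ?thesis
      by eventually_elim (use that in auto)
  qed
  then have "open {x. c < \<psi> x}"
    unfolding open_subopen[of "{x. c < \<psi> x}"] by (simp add: eventually_nhds subset_eq)
  then show ?thesis
    by (simp add: closed_def Collect_neg_eq[symmetric] not_le)
qed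

lemma closed_sublevel_add_continuous:
  fixes \<psi> :: "'a::metric_space \<Rightarrow> ereal" and c :: "'a \<Rightarrow> real"
  assumes "lsc \<psi>" and c: "continuous_on UNIV c"
  shows "closed {x. \<psi> x + ereal (c x) \<le> r}"
  unfolding closed_sequential_limits
proof (intro allI impI, elim conjE)
  fix s l
  assume s: "\<forall>n. s n \<in> {x. \<psi> x + ereal (c x) \<le> r}" and lim: "s \<longlonglongrightarrow> l"
  \<comment> \<open>Continuity of \<open>c\<close> lets its value at \<open>s n\<close> be replaced
    by \<open>c l\<close> at the cost of \<open>\<eta>\<close>, so a tail of the sequence lies in
    one fixed closed sublevel set of \<open>\<psi>\<close>.\<close>
  have "\<psi> l \<le> (r - ereal (c l)) + ereal \<eta>" if "0 < \<eta>" for \<eta>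
  proof -
    have "(\<lambda>n. c (s n)) \<longlonglongrightarrow> c l"
      using c lim by (rule continuous_on_tendsto_compose) auto
    then have "\<forall>\<^sub>F n in sequentially. c l - \<eta> < c (s n)"
      using that by (intro order_tendstoD) auto
    then have "\<forall>\<^sub>F n in sequentially. s n \<in> {x. \<psi> x \<le> (r - ereal (c l)) + ereal \<eta>}"
    proof eventually_elim
      case (elim n)
      have "\<psi> (s n) + ereal (c (s n)) \<le> r" using s by simp
      with elim show ?case
        by (cases "\<psi> (s n)"; cases r) auto
    qed
    then show ?thesis
      using Lim_in_closed_set[OF lsc_closed_sublevel[OF assms(1)] _ _ lim] by auto
  qed
  then have "\<psi> l \<le> r - ereal (c l)"
    by (rule ereal_le_epsilon2)
  then show "l \<in> {x. \<psi> x + ereal (c x) \<le> r}"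
    by (cases "\<psi> l"; cases r) auto
qed

section \<open>From the extended distance to real arithmetic\<close>

lemma edist_le: "z \<in> C \<Longrightarrow> edist x C \<le> ereal (norm (x - z))"
  unfolding edist_def by (rule INF_lower)

lemma edist_infdist:
  assumes "C \<noteq> {}"
  shows "edist x C = ereal (infdist x C)"
proof (rule antisym)
  show "ereal (infdist x C) \<le> edist x C"
    unfolding edist_def by (intro INF_greatest) (auto simp: dist_norm[symmetric] infdist_le)
  obtain p where p: "p \<in> C" using assms by auto
  have "0 \<le> edist x C"
    unfolding edist_def by (intro INF_greatest) auto
  moreover have "edist x C < \<infinity>"
    using edist_le[OF p] by (rule le_less_trans) simp
  ultimately obtain r where r: "edist x C = ereal r"
    by (cases "edist x C") auto
  have "r \<le> dist x a" if "a \<in> C" for a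
    using edist_le[OF that, of x] by (simp add: r dist_norm)
  then show "edist x C \<le> ereal (infdist x C)"
    using assms by (simp add: r infdist_def cINF_greatest)
qed

text \<open>Reduces an error bound to single elements of \<open>S\<close>. If \<open>S\<close> is
  empty the right-hand side is infinite, because \<open>c\<close> is positive.\<close>

lemma le_mult_edist:
  assumes "0 < c" and le: "\<And>z. z \<in> S \<Longrightarrow> d \<le> c * norm (x - z)"
  shows "ereal d \<le> ereal c * edist x S"
proof (cases "S = {}")
  case True
  then show ?thesis
    using \<open>0 < c\<close> by (simp add: edist_def top_ereal_def)
next
  case False
  have "d / c \<le> dist x z" if "z \<in> S" for z
    using le[OF that] \<open>0 < c\<close> by (simp add: dist_norm field_simps)
  then have "d / c \<le> infdist x S"
    using False by (simp add: infdist_def cINF_greatest)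
  then show ?thesis
    using \<open>0 < c\<close> by (simp add: edist_infdist[OF False] field_simps)
qed

section \<open>A single proximal step with a fixed kernel\<close>

locale bregman_step =
  fixes f :: "'a::euclidean_space \<Rightarrow> real" and g :: "'a \<Rightarrow> ereal" and K :: "'a \<Rightarrow> real"
    and L m M e :: real
  assumes f_diff: "f differentiable_on UNIV"
    and f_lip: "L-lipschitz_on UNIV (grad f)"
    and K_diff: "K differentiable_on UNIV"
    and K_sc: "strongly_convex m K"
    and K_lip: "M-lipschitz_on UNIV (grad K)"
    and e_pos: "0 < e"
    and g_proper: "proper_fun g"
begin

abbreviation F :: "'a \<Rightarrow> ereal" where
  "F \<equiv> objective (\<lambda>u. ereal (f u)) g"

abbreviation T :: "'a \<Rightarrow> 'a set" where
  "T \<equiv> prox_map (\<lambda>u. ereal (f u)) g (bregman K) e"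

text \<open>The finite part of the subproblem, so that \<open>g\<close> is its only extended-real
  term. As a function of \<open>y\<close> it is \<open>K y / e\<close> plus an affine
  function.\<close>

definition model :: "'a \<Rightarrow> 'a \<Rightarrow> real" where
  "model x y = inner (grad f x) (y - x) + 1 / e * bregman K x y"

lemma f_gderiv: "GDERIV f x :> grad f x"
  using f_diff by (intro gderiv_grad) (auto simp: differentiable_on_def)

lemma K_gderiv: "GDERIV K x :> grad K x"
  using K_diff by (intro gderiv_grad) (auto simp: differentiable_on_def)

lemmas f_upper = descent_upper[OF f_gderiv f_lip]
  and f_lower = descent_lower[OF f_gderiv f_lip]
  and K_upper = descent_upper[OF K_gderiv K_lip]
  and K_lower = strongly_convex_lower[OF K_sc K_gderiv K_lip]

lemma bregman_lower: "m / 2 * (norm (y - x))\<^sup>2 \<le> bregman K x y"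
  using K_lower[of x y] by (simp add: bregman_def)

lemma bregman_upper: "bregman K x y \<le> M / 2 * (norm (y - x))\<^sup>2"
  using K_upper[of y x] by (simp add: bregman_def)

lemma model_lower: "inner (grad f x) (y - x) + m / e / 2 * (norm (y - x))\<^sup>2 \<le> model x y"
  using mult_left_mono[OF bregman_lower[of y x], of "1 / e"] e_pos
  by (simp add: model_def field_simps)

lemma model_upper: "model x y \<le> inner (grad f x) (y - x) + M / e / 2 * (norm (y - x))\<^sup>2"
  using mult_left_mono[OF bregman_upper[of x y], of "1 / e"] e_pos
  by (simp add: model_def field_simps)

lemma mem_T_iff: "z \<in> T x \<longleftrightarrow> (\<forall>y. g z + ereal (model x z) \<le> g y + ereal (model x y))"
proof -
  have "ereal (inner (grad f x) (y - x)) + g y + ereal (1 / e * bregman K x y)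
      = g y + ereal (model x y)" for y
    unfolding model_def by (cases "g y") auto
  then show ?thesis
    by (simp add: prox_map_def is_arg_min_linorder)
qed

lemma g_real: "y \<in> effdom g \<Longrightarrow> g y = ereal (real_of_ereal (g y))"
  using g_proper by (cases "g y") (auto simp: effdom_def proper_fun_def)

lemma F_real: "y \<in> effdom g \<Longrightarrow> F y = ereal (f y + real_of_ereal (g y))"
  using g_real[of y] by (simp add: objective_def) (metis plus_ereal.simps(1))

lemma effdom_F: "y \<in> effdom g \<longleftrightarrow> F y < \<infinity>"
  using g_proper by (cases "g y") (auto simp: effdom_def objective_def proper_fun_def)

lemma T_effdom:
  assumes "z \<in> T x"
  shows "z \<in> effdom g"
proof -
  obtain y where "y \<in> effdom g" using g_proper by (auto simp: proper_fun_def)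
  with assms g_real[of y] show ?thesis
    by (cases "g z"; cases "g y") (auto simp: mem_T_iff effdom_def dest!: spec[of _ y])
qed

lemma T_le:
  assumes "z \<in> T x" "y \<in> effdom g"
  shows "real_of_ereal (g z) + model x z \<le> real_of_ereal (g y) + model x y"
  using assms(1)[unfolded mem_T_iff, rule_format, of y]
    g_real[OF T_effdom[OF assms(1)]] g_real[OF assms(2)]
  by (metis plus_ereal.simps(1) ereal_less_eq(3))

lemma T_F_le:
  assumes "z \<in> T x" "p \<in> effdom g"
  shows "f z + real_of_ereal (g z) + (m / e - L) / 2 * (norm (z - x))\<^sup>2
      \<le> f p + real_of_ereal (g p) + (M / e + L) / 2 * (norm (p - x))\<^sup>2"
  \<comment> \<open>Linearizing \<open>f\<close> at \<open>x\<close>, from above at \<open>z\<close>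
    and from below at \<open>p\<close>, cancels the inner products with \<open>grad f x\<close> in
    the two model bounds.\<close>
  using T_le[OF assms] model_lower[of x z] model_upper[of x p] f_upper[of z x] f_lower[of x p]
  by (simp add: diff_divide_distrib add_divide_distrib algebra_simps)

lemma T_descent:
  assumes "z \<in> T x" "L \<le> m / e"
  shows "F z \<le> F x"
proof (cases "x \<in> effdom g")
  case True
  have "0 \<le> (m / e - L) / 2 * (norm (z - x))\<^sup>2"
    using assms(2) by simp
  then show ?thesis
    using T_F_le[OF assms(1) True] by (simp del: times_divide_eq_left add: F_real True T_effdom[OF assms(1)])
qed (auto simp: effdom_F)

lemma T_contraction:
  assumes "z \<in> T x" "F p \<le> F z"
  shows "(norm (z - p))\<^sup>2
      \<le> (M / e + L + 2) * (norm (p - x))\<^sup>2 - (m / e - L - 2) * (norm (z - x))\<^sup>2"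
proof -
  have p: "p \<in> effdom g"
    using assms T_effdom effdom_F by (metis le_less_trans)
  have "f p + real_of_ereal (g p) \<le> f z + real_of_ereal (g z)"
    using assms(2) by (simp add: F_real p T_effdom[OF assms(1)])
  then have "(m / e - L) * (norm (z - x))\<^sup>2 \<le> (M / e + L) * (norm (p - x))\<^sup>2"
    using T_F_le[OF assms(1) p] by argo
  moreover have "(norm (z - p))\<^sup>2 \<le> 2 * (norm (z - x))\<^sup>2 + 2 * (norm (p - x))\<^sup>2"
  proof -
    have "(norm (z - p))\<^sup>2 \<le> (norm (z - x) + norm (p - x))\<^sup>2"
      using norm_triangle_ineq4[of "z - x" "p - x"] by (intro power_mono) auto
    then show ?thesis
      using sum_squares_bound[of "norm (z - x)" "norm (p - x)"] by (simp add: power2_sum)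
  qed
  ultimately show ?thesis
    by (simp add: algebra_simps)
qed

text \<open>The element of \<open>\<partial>\<^sub>P F(z)\<close> that the first-order optimality condition of \<open>z \<in> T(x)\<close> produces.\<close>

definition residual :: "'a \<Rightarrow> 'a \<Rightarrow> 'a" where
  "residual x z = grad f z - grad f x - (1 / e) *\<^sub>R (grad K z - grad K x)"

lemma norm_residual: "norm (residual x z) \<le> (L + M / e) * norm (x - z)"
proof -
  have "norm (grad f z - grad f x) \<le> L * norm (x - z)"
    using lipschitz_onD[OF f_lip, of z x] by (simp add: dist_norm norm_minus_commute)
  moreover have "norm (grad K z - grad K x) \<le> M * norm (x - z)"
    using lipschitz_onD[OF K_lip, of z x] by (simp add: dist_norm norm_minus_commute)
  then have "norm ((1 / e) *\<^sub>R (grad K z - grad K x)) \<le> M / e * norm (x - z)"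
    unfolding norm_scaleR using e_pos by (simp add: divide_right_mono)
  ultimately show ?thesis
    unfolding residual_def
    using norm_triangle_ineq4[of "grad f z - grad f x" "(1 / e) *\<^sub>R (grad K z - grad K x)"]
    by (simp add: algebra_simps)
qed

lemma residual_subdiff:
  assumes z: "z \<in> T x" and "0 < L"
  shows "residual x z \<in> prox_subdiff F z"
proof -
  \<comment> \<open>\<open>L / 2\<close> is the error of the lower descent bound for
    \<open>f\<close> at \<open>z\<close>, and \<open>M / (2 * e)\<close> that of the upper bound for
    \<open>K / e\<close>. The inequality below holds for every \<open>u\<close>, so
    \<open>\<delta> = 1\<close> serves as the radius.\<close>
  define \<rho> where "\<rho> = (L + M / e) / 2"
  have "0 < \<rho>"
    using \<open>0 < L\<close> lipschitz_on_nonneg[OF K_lip] e_pos by (simp add: \<rho>_def add_pos_nonneg)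
  moreover have "F z + ereal (inner (residual x z) (u - z)) - ereal (\<rho> * (norm (u - z))\<^sup>2) \<le> F u" for u
  proof (cases "u \<in> effdom g")
    case True
    have "1 / e * (K u - K z) \<le> 1 / e * (inner (grad K z) (u - z) + M / 2 * (norm (u - z))\<^sup>2)"
      using K_upper[of u z] e_pos by (intro mult_left_mono) auto
    then have "model x u - model x z
        \<le> inner (grad f x) (u - z) + 1 / e * inner (grad K z - grad K x) (u - z) + M / e / 2 * (norm (u - z))\<^sup>2"
      by (simp add: model_def bregman_def algebra_simps diff_divide_distrib add_divide_distrib)
    then have "f z + real_of_ereal (g z) + inner (residual x z) (u - z) - \<rho> * (norm (u - z))\<^sup>2
        \<le> f u + real_of_ereal (g u)"
      using T_le[OF z True] f_lower[of z u]
      by (simp add: residual_def \<rho>_def algebra_simps diff_divide_distrib add_divide_distrib)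
    then show ?thesis
      by (simp add: F_real True T_effdom[OF z])
  qed (auto simp: effdom_F)
  moreover have "z \<in> effdom F"
    using T_effdom[OF z] effdom_F by (simp add: effdom_def)
  ultimately show ?thesis
    unfolding prox_subdiff_def by (blast intro: zero_less_one)
qed

section \<open>Semi-convex \<open>g\<close>: strong minimality and global subgradients\<close>

lemma semi_convex_combination:
  assumes sc: "semi_convex \<rho> g" and "convex (effdom g)"
    and x: "x \<in> effdom g" and y: "y \<in> effdom g" and t: "0 \<le> t" "t \<le> 1"
  shows "x + t *\<^sub>R (y - x) \<in> effdom g"
    and "real_of_ereal (g (x + t *\<^sub>R (y - x)))
      \<le> (1 - t) * real_of_ereal (g x) + t * real_of_ereal (g y) + \<rho> / 2 * t * (1 - t) * (norm (y - x))\<^sup>2"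
proof -
  have eq: "x + t *\<^sub>R (y - x) = (1 - t) *\<^sub>R x + t *\<^sub>R y"
    by (simp add: algebra_simps)
  \<comment> \<open>The representation of \<open>g\<close> by \<open>h\<close> is available on
    \<open>effdom g\<close> alone; convexity of the domain keeps the intermediate point
    there.\<close>
  show w: "x + t *\<^sub>R (y - x) \<in> effdom g"
    unfolding eq using assms by (auto intro!: convexD)
  obtain h where h: "convex_on UNIV h"
    and g: "\<And>u. u \<in> effdom g \<Longrightarrow> g u = ereal (h u - \<rho> / 2 * (norm u)\<^sup>2)"
    using sc by (auto simp: semi_convex_def)
  have "h (x + t *\<^sub>R (y - x)) \<le> (1 - t) * h x + t * h y"
    unfolding eq using convex_onD[OF h, of t x y] t by simp
  moreover have "(norm (x + t *\<^sub>R (y - x)))\<^sup>2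
      = (1 - t) * (norm x)\<^sup>2 + t * (norm y)\<^sup>2 - t * (1 - t) * (norm (y - x))\<^sup>2"
    unfolding power2_norm_eq_inner
    by (simp add: inner_diff_left inner_diff_right inner_add_left inner_add_right inner_commute
        algebra_simps power2_eq_square)
  then have "real_of_ereal (g (x + t *\<^sub>R (y - x))) = h (x + t *\<^sub>R (y - x))
      - \<rho> / 2 * ((1 - t) * (norm x)\<^sup>2 + t * (norm y)\<^sup>2 - t * (1 - t) * (norm (y - x))\<^sup>2)"
    by (simp only: g[OF w] real_of_ereal.simps)
  ultimately show "real_of_ereal (g (x + t *\<^sub>R (y - x)))
      \<le> (1 - t) * real_of_ereal (g x) + t * real_of_ereal (g y) + \<rho> / 2 * t * (1 - t) * (norm (y - x))\<^sup>2"
    using g[OF x] g[OF y] by (simp add: algebra_simps add_divide_distrib diff_divide_distrib)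
qed

text \<open>Affine terms do not affect strong convexity, so the modulus \<open>m / e\<close> is
  inherited from \<open>K / e\<close>.\<close>

lemma model_combination:
  assumes "0 \<le> t" "t \<le> 1"
  shows "model x (z + t *\<^sub>R (y - z))
      \<le> (1 - t) * model x z + t * model x y - m / e / 2 * t * (1 - t) * (norm (y - z))\<^sup>2"
proof -
  have eq: "z + t *\<^sub>R (y - z) = (1 - t) *\<^sub>R z + t *\<^sub>R y"
    by (simp add: algebra_simps)
  have "1 / e * K (z + t *\<^sub>R (y - z))
      \<le> 1 / e * ((1 - t) * K z + t * K y - m / 2 * t * (1 - t) * (norm (y - z))\<^sup>2)"
    unfolding eq
    using K_sc[unfolded strongly_convex_def, rule_format, of t z y] assms e_pos
    by (intro mult_left_mono) (auto simp: norm_minus_commute)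
  then show ?thesis
    by (simp add: model_def bregman_def algebra_simps diff_divide_distrib add_divide_distrib)
qed

text \<open>The moduli \<open>m / e\<close> of the model and \<open>-\<rho>\<close> of
  \<open>g\<close> add up. Comparing \<open>z\<close> with points of the segment towards
  \<open>y\<close> and letting these tend to \<open>z\<close> gives quadratic growth at the
  minimizer.\<close>

lemma T_strong_minimum:
  assumes sc: "semi_convex \<rho> g" and cv: "convex (effdom g)"
    and z: "z \<in> T x" and y: "y \<in> effdom g"
  shows "real_of_ereal (g z) + model x z + (m / e - \<rho>) / 2 * (norm (y - z))\<^sup>2
      \<le> real_of_ereal (g y) + model x y"
proof -
  let ?\<mu> = "(m / e - \<rho>) / 2 * (norm (y - z))\<^sup>2"
  have "real_of_ereal (g z) + model x z + ?\<mu> - (real_of_ereal (g y) + model x y) \<le> 0"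
  proof (rule nonpos_if_mult_le_square[of 1 _ ?\<mu>])
    fix t :: real assume t: "0 < t" "t < 1"
    note w = semi_convex_combination[OF sc cv T_effdom[OF z] y, of t]
    show "t * (real_of_ereal (g z) + model x z + ?\<mu> - (real_of_ereal (g y) + model x y)) \<le> t\<^sup>2 * ?\<mu>"
      using T_le[OF z w(1)] w(2) model_combination[of t x z y] t
      by (simp add: algebra_simps diff_divide_distrib power2_eq_square)
  qed simp
  then show ?thesis by simp
qed

text \<open>The proximal subgradient inequality is only local; for semi-convex \<open>g\<close> it extends to all of
  \<open>effdom g\<close> by shrinking the segment from \<open>x\<close> to \<open>y\<close>.\<close>

lemma prox_subdiff_global:
  assumes sc: "semi_convex \<rho> g" and cv: "convex (effdom g)"
    and \<xi>: "\<xi> \<in> prox_subdiff F x" and y: "y \<in> effdom g"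
  shows "real_of_ereal (g x) + inner (\<xi> - grad f x) (y - x) - \<rho> / 2 * (norm (y - x))\<^sup>2
      \<le> real_of_ereal (g y)"
proof -
  let ?n = "(norm (y - x))\<^sup>2"
  obtain \<rho>' \<delta> where \<delta>: "0 < \<delta>"
    and loc: "\<And>u. norm (u - x) < \<delta> \<Longrightarrow>
      F x + ereal (inner \<xi> (u - x)) - ereal (\<rho>' * (norm (u - x))\<^sup>2) \<le> F u"
    using \<xi> by (auto simp: prox_subdiff_def)
  have x: "x \<in> effdom g"
    using \<xi> effdom_F by (auto simp: prox_subdiff_def effdom_def)
  \<comment> \<open>The bound 1 keeps \<open>t\<close> a convex weight; the quotient keeps the point
    within distance \<open>\<delta>\<close> of \<open>x\<close>, and the added 1 avoids division by
    zero.\<close>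
  define \<eta> where "\<eta> = min 1 (\<delta> / (norm (y - x) + 1))"
  have "0 < \<eta>"
    using \<delta> by (auto simp: \<eta>_def add_nonneg_pos)
  \<comment> \<open>The coefficients of \<open>t\<^sup>2\<close> are \<open>\<rho>'\<close> from the
    local inequality, \<open>L / 2\<close> from the descent lemma for \<open>f\<close>, and
    \<open>-\<rho> / 2\<close> from \<open>\<rho> / 2 * t * (1 - t)\<close>.\<close>
  have "real_of_ereal (g x) + inner (\<xi> - grad f x) (y - x) - \<rho> / 2 * ?n - real_of_ereal (g y) \<le> 0"
  proof (rule nonpos_if_mult_le_square[OF \<open>0 < \<eta>\<close>, of _ "(\<rho>' + L / 2 - \<rho> / 2) * ?n"])
    fix t assume t: "0 < t" "t < \<eta>"
    let ?w = "x + t *\<^sub>R (y - x)"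
    have "t \<le> 1" using t by (simp add: \<eta>_def)
    note w = semi_convex_combination[OF sc cv x y, of t]
    have "t * norm (y - x) \<le> t * (norm (y - x) + 1)"
      using t by simp
    also have "\<dots> < \<delta>"
      using t by (simp add: \<eta>_def pos_less_divide_eq add_nonneg_pos)
    finally have "norm (?w - x) < \<delta>"
      using t by simp
    from loc[OF this] have "f x + real_of_ereal (g x) + t * inner \<xi> (y - x) - \<rho>' * (t\<^sup>2 * ?n)
        \<le> f ?w + real_of_ereal (g ?w)"
      using w(1) t \<open>t \<le> 1\<close> by (simp add: F_real x power_mult_distrib)
    moreover have "f ?w \<le> f x + t * inner (grad f x) (y - x) + L / 2 * (t\<^sup>2 * ?n)"
      using f_upper[of ?w x] by (simp add: power_mult_distrib)
    ultimately show "t * (real_of_ereal (g x) + inner (\<xi> - grad f x) (y - x) - \<rho> / 2 * ?n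
          - real_of_ereal (g y)) \<le> t\<^sup>2 * ((\<rho>' + L / 2 - \<rho> / 2) * ?n)"
      using w(2) t \<open>t \<le> 1\<close> by (simp add: inner_diff_left algebra_simps power2_eq_square add_divide_distrib diff_divide_distrib)
  qed
  then show ?thesis by simp
qed

text \<open>Strong minimality of \<open>z\<close> tested at \<open>x\<close> and the global
  subgradient inequality at \<open>x\<close> tested at \<open>z\<close> are added, which cancels the
  values of \<open>g\<close>. Each contributes a quadratic term, and \<open>model_lower\<close>
  supplies the rest of the factor \<open>m / e - \<rho>\<close>; Cauchy-Schwarz finishes.\<close>

lemma T_step_le_subgradient:
  assumes sc: "semi_convex \<rho> g" and cv: "convex (effdom g)"
    and \<xi>: "\<xi> \<in> prox_subdiff F x" and z: "z \<in> T x"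
  shows "(m / e - \<rho>) * norm (x - z) \<le> norm \<xi>"
proof (cases "x = z")
  case False
  have x: "x \<in> effdom g"
    using \<xi> effdom_F by (auto simp: prox_subdiff_def effdom_def)
  define q where "q = m / e"
  have "model x x = 0"
    by (simp add: model_def bregman_def)
  then have "(q - \<rho>) * (norm (x - z))\<^sup>2 \<le> inner \<xi> (x - z)"
    using T_strong_minimum[OF sc cv z x] prox_subdiff_global[OF sc cv \<xi> T_effdom[OF z]]
      model_lower[of x z] unfolding q_def[symmetric]
    by (simp add: inner_diff_left inner_diff_right norm_minus_commute[of z x] algebra_simps
        diff_divide_distrib)
  also have "\<dots> \<le> norm \<xi> * norm (x - z)"
    by (rule norm_cauchy_schwarz)
  finally show ?thesis
    using False by (simp add: q_def power2_eq_square mult.assoc[symmetric])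
qed simp

text \<open>The sublevel sets of the proximal subproblem lie in those of \<open>F\<close>, as \<open>f\<close> is majorized by its
  linearization plus \<open>D / e\<close>.\<close>

lemma T_nonempty:
  assumes "lsc g" "level_bounded F" "L \<le> m / e"
  shows "T x \<noteq> {}"
proof -
  let ?\<phi> = "\<lambda>y. g y + ereal (model x y)"
  have F_le: "F y \<le> ereal (f x) + ?\<phi> y" for y
  proof -
    have "L / 2 * (norm (y - x))\<^sup>2 \<le> m / e / 2 * (norm (y - x))\<^sup>2"
      using assms(3) by (intro mult_right_mono) auto
    then have "f y \<le> f x + model x y"
      using f_upper[of y x] model_lower[of x y] by linarith
    then show ?thesis
      by (cases "g y") (auto simp: objective_def)
  qed
  have "continuous_on UNIV K"
    by (rule differentiable_imp_continuous_on[OF K_diff])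
  then have cont: "continuous_on UNIV (model x)"
    unfolding model_def bregman_def by (intro continuous_intros) auto
  have compact: "compact {y. ?\<phi> y \<le> ?\<phi> z}" if z: "z \<in> effdom g" for z
  proof -
    obtain r where r: "?\<phi> z = ereal r"
      using g_real[OF z] by (metis plus_ereal.simps(1))
    have "{y. ?\<phi> y \<le> ?\<phi> z} \<subseteq> {y. F y \<le> ereal (f x + r)}"
      using F_le by (auto simp: r) (metis add_left_mono order_trans plus_ereal.simps(1))
    then have "bounded {y. ?\<phi> y \<le> ?\<phi> z}"
      using assms(2) bounded_subset unfolding level_bounded_def by blast
    then show ?thesis
      using closed_sublevel_add_continuous[OF assms(1) cont] compact_eq_bounded_closed by blast
  qed
  let ?S = "(\<lambda>z. {y. ?\<phi> y \<le> ?\<phi> z}) ` effdom g"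
  \<comment> \<open>The sublevel sets at points of \<open>effdom g\<close> form a chain of nonempty
    compact sets. A common point has value at most that of every point of the domain, hence is a
    minimizer.\<close>
  have "\<Inter> ?S \<noteq> {}"
  proof (rule compact_chain)
    have mono: "{y. ?\<phi> y \<le> c} \<subseteq> {y. ?\<phi> y \<le> d}" if "c \<le> d" for c d
      using that by (intro Collect_mono impI) (erule order_trans)
    show "A \<subseteq> B \<or> B \<subseteq> A" if AB: "A \<in> ?S \<and> B \<in> ?S" for A B
    proof -
      obtain a b where "A = {y. ?\<phi> y \<le> ?\<phi> a}" "B = {y. ?\<phi> y \<le> ?\<phi> b}"
        using AB by blast
      then show ?thesis
        using mono linear[of "?\<phi> a" "?\<phi> b"] by blast
    qed
  qed (use compact in auto)
  then obtain z where z: "\<And>y. y \<in> effdom g \<Longrightarrow> ?\<phi> z \<le> ?\<phi> y"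
    by auto
  have "?\<phi> z \<le> ?\<phi> y" for y
    using z[of y] by (cases "y \<in> effdom g") (auto simp: effdom_def)
  then show ?thesis
    using mem_T_iff[of z x] by blast
qed

end

section \<open>The method with varying kernels and step sizes\<close>

locale vbpg_setting =
  fixes f :: "'a::euclidean_space \<Rightarrow> real" and g :: "'a \<Rightarrow> ereal"
    and K :: "nat \<Rightarrow> 'a \<Rightarrow> real" and \<epsilon> :: "nat \<Rightarrow> real"
    and L m M \<epsilon>l \<epsilon>u :: real
  assumes f_diff: "f differentiable_on UNIV"
    and f_lip: "L-lipschitz_on UNIV (grad f)"
    and L_pos: "0 < L"
    and g_proper: "proper_fun g"
    and g_lsc: "lsc g"
    and g_dom: "convex (effdom g)"
    and F_bounded: "level_bounded (objective (\<lambda>u. ereal (f u)) g)"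
    and K_diff: "K k differentiable_on UNIV"
    and K_sc: "strongly_convex m (K k)"
    and K_lip: "M-lipschitz_on UNIV (grad (K k))"
    and m_pos: "0 < m"
    and \<epsilon>l_pos: "0 < \<epsilon>l"
    and \<epsilon>_lower: "\<epsilon>l \<le> \<epsilon> k"
    and \<epsilon>_upper: "\<epsilon> k \<le> \<epsilon>u"
begin

lemma \<epsilon>_pos: "0 < \<epsilon> k"
  using \<epsilon>l_pos \<epsilon>_lower by (rule less_le_trans)

sublocale step: bregman_step f g "K k" L m M "\<epsilon> k" for k
  by unfold_locales (use f_diff f_lip K_diff K_sc K_lip \<epsilon>_pos g_proper in auto)

abbreviation F :: "'a \<Rightarrow> ereal" where
  "F \<equiv> objective (\<lambda>u. ereal (f u)) g"

lemma M_nonneg: "0 \<le> M"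
  using K_lip by (rule lipschitz_on_nonneg)

lemma \<epsilon>u_pos: "0 < \<epsilon>u"
  using \<epsilon>_pos \<epsilon>_upper by (rule less_le_trans)

lemma m_div_\<epsilon>: "m / \<epsilon>u \<le> m / \<epsilon> k"
  using m_pos \<epsilon>_pos[of k] \<epsilon>_upper[of k] by (intro divide_left_mono) auto

lemma M_div_\<epsilon>: "M / \<epsilon> k \<le> M / \<epsilon>l"
  using M_nonneg \<epsilon>l_pos \<epsilon>_lower[of k] \<epsilon>_pos[of k] by (intro divide_left_mono) auto

lemma closed_level_le: "closed (level_le F c)"
proof -
  have "continuous_on UNIV f"
    by (rule differentiable_imp_continuous_on[OF f_diff])
  from closed_sublevel_add_continuous[OF g_lsc this] show ?thesis
    by (simp add: level_le_def objective_def add.commute)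
qed

lemma vbpg_level_le:
  assumes "L \<le> m / \<epsilon>u" and "vbpg (\<lambda>u. ereal (f u)) g K \<epsilon> y"
  shows "F (y (Suc k)) \<le> F (y k)" and "F (y k) \<le> F (y 0)"
proof -
  show desc: "F (y (Suc k)) \<le> F (y k)" for k
    using assms(2) order_trans[OF assms(1) m_div_\<epsilon>]
    by (intro step.T_descent) (auto simp: vbpg_def)
  show "F (y k) \<le> F (y 0)"
    by (induction k) (auto intro: order_trans[OF desc])
qed

section \<open>From the proximal error bound to the linear rate\<close>

lemma linear_convergence:
  fixes \<bb> \<cc> \<theta> \<beta> \<nu> :: real
  defines "\<bb> \<equiv> M / \<epsilon>l + 2 + 3 * L" and "\<cc> \<equiv> m / \<epsilon>u - (L + 2)"
  assumes ne: "level_le F Fbar \<noteq> {}"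
    and y: "vbpg (\<lambda>u. ereal (f u)) g K \<epsilon> y" and y0: "y 0 \<in> band F Fbar \<nu>"
    and EB: "strong_bregman_EB (\<lambda>u. ereal (f u)) g K \<epsilon> Fbar \<nu> \<theta>"
    and \<theta>: "sqrt (\<cc> / \<bb>) < \<theta>" "\<theta> < sqrt (\<cc> / (\<bb> - 1))"
    and \<beta>: "\<beta> = sqrt (\<bb> - \<cc> / \<theta>\<^sup>2)"
  shows "0 < \<beta>" and "\<beta> < 1" and "level_linear_conv F Fbar \<beta> y"
proof -
  let ?C = "level_le F Fbar"
  have b: "2 < \<bb>"
    using M_nonneg \<epsilon>l_pos L_pos by (simp add: \<bb>_def add_nonneg_pos)
  \<comment> \<open>Positivity follows from the interval for \<open>\<theta>\<close> being nonempty: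
    if \<open>\<cc> \<le> 0\<close>, the smaller denominator \<open>\<bb> - 1\<close> gives the
    smaller quotient.\<close>
  have c: "0 < \<cc>"
  proof (rule ccontr)
    assume "\<not> 0 < \<cc>"
    then have "\<cc> / (\<bb> - 1) \<le> \<cc> / \<bb>"
      using b by (simp add: divide_simps algebra_simps)
    then have "sqrt (\<cc> / (\<bb> - 1)) \<le> sqrt (\<cc> / \<bb>)"
      by simp
    with \<theta> show False by simp
  qed
  have \<theta>_pos: "0 < \<theta>"
    using EB by (simp add: strong_bregman_EB_def)
  have "(sqrt (\<cc> / \<bb>))\<^sup>2 < \<theta>\<^sup>2" "\<theta>\<^sup>2 < (sqrt (\<cc> / (\<bb> - 1)))\<^sup>2"
    by (intro power_strict_mono; use \<theta> \<theta>_pos b c in simp)+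
  then have "\<cc> / \<bb> < \<theta>\<^sup>2" "\<theta>\<^sup>2 < \<cc> / (\<bb> - 1)"
    using b c by auto
  \<comment> \<open>These two inequalities say exactly that
    \<open>\<bb> - \<cc> / \<theta>\<^sup>2\<close> lies strictly between 0 and 1.\<close>
  then have ratio: "\<bb> - 1 < \<cc> / \<theta>\<^sup>2" "\<cc> / \<theta>\<^sup>2 < \<bb>"
    using b c \<theta>_pos by (simp_all add: field_simps)
  show \<beta>_pos: "0 < \<beta>" and "\<beta> < 1"
    using ratio by (auto simp: \<beta>)
  have \<beta>_sq: "\<beta>\<^sup>2 = \<bb> - \<cc> / \<theta>\<^sup>2"
    using ratio by (simp add: \<beta>)
  have L_le: "L \<le> m / \<epsilon>u"
    using c by (simp add: \<cc>_def)
  have "infdist (y (Suc k)) ?C \<le> \<beta> * infdist (y k) ?C" for k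
  proof (cases "F (y (Suc k)) \<le> Fbar")
    case True
    then have "infdist (y (Suc k)) ?C = 0"
      by (simp add: level_le_def)
    then show ?thesis
      using \<beta>_pos by (simp add: infdist_nonneg)
  next
    case False
    define d where "d = infdist (y k) ?C"
    define s where "s = norm (y (Suc k) - y k)"
    have z: "y (Suc k) \<in> prox_map (\<lambda>u. ereal (f u)) g (bregman (K k)) (\<epsilon> k) (y k)"
      using y by (simp add: vbpg_def)
    \<comment> \<open>Monotonicity of \<open>F\<close> along the iterates: \<open>F (y k)\<close> is
      at least \<open>F (y (Suc k))\<close>, which exceeds \<open>Fbar\<close>, and at most
      \<open>F (y 0)\<close>. So the error bound applies at \<open>y k\<close>.\<close>
    have "y k \<in> band F Fbar \<nu>"
      using False vbpg_level_le[OF L_le y, of k] y0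
      by (auto simp: band_def not_le intro: less_le_trans le_less_trans)
    then have "ereal d \<le> ereal \<theta>
        * edist (y k) (prox_map (\<lambda>u. ereal (f u)) g (bregman (K k)) (\<epsilon> k) (y k))"
      using EB by (simp add: strong_bregman_EB_def d_def edist_infdist[OF ne])
    also have "\<dots> \<le> ereal \<theta> * ereal s"
      using edist_le[OF z, of "y k"] \<theta>_pos
      by (intro ereal_mult_left_mono) (auto simp: s_def norm_minus_commute)
    finally have "d \<le> \<theta> * s"
      by simp
    then have "d\<^sup>2 \<le> (\<theta> * s)\<^sup>2"
      by (intro power_mono) (auto simp: d_def infdist_nonneg)
    then have s: "d\<^sup>2 / \<theta>\<^sup>2 \<le> s\<^sup>2"
      using \<theta>_pos by (simp add: field_simps)
    obtain p where p: "p \<in> ?C" and d: "d = norm (p - y k)"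
      using infdist_attains_inf[OF closed_level_le ne, of "y k"]
      by (metis d_def dist_norm dist_commute)
    have "F p \<le> F (y (Suc k))"
      using p False by (simp add: level_le_def)
    then have "(norm (y (Suc k) - p))\<^sup>2 \<le> (M / \<epsilon> k + L + 2) * d\<^sup>2 - (m / \<epsilon> k - L - 2) * s\<^sup>2"
      using step.T_contraction[OF z] by (simp add: d s_def)
    \<comment> \<open>Constants independent of \<open>k\<close> replace those of the step, using the
      bounds on \<open>\<epsilon> k\<close> and \<open>L \<le> 3 * L\<close>.\<close>
    also have "\<dots> \<le> \<bb> * d\<^sup>2 - \<cc> * s\<^sup>2"
      using M_div_\<epsilon>[of k] m_div_\<epsilon>[of k] L_pos
      by (intro diff_mono mult_right_mono) (auto simp: \<bb>_def \<cc>_def)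
    also have "\<dots> \<le> \<bb> * d\<^sup>2 - \<cc> * (d\<^sup>2 / \<theta>\<^sup>2)"
      using s c by (intro diff_left_mono mult_left_mono) auto
    also have "\<dots> = (\<beta> * d)\<^sup>2"
      by (simp add: power_mult_distrib \<beta>_sq algebra_simps)
    finally have "norm (y (Suc k) - p) \<le> \<beta> * d"
      by (rule power2_le_imp_le) (use \<beta>_pos in \<open>simp add: d\<close>)
    moreover have "infdist (y (Suc k)) ?C \<le> norm (y (Suc k) - p)"
      using infdist_le[OF p] by (simp add: dist_norm)
    ultimately show ?thesis
      by (simp add: d_def)
  qed
  then show "level_linear_conv F Fbar \<beta> y"
    by (simp add: level_linear_conv_def edist_infdist[OF ne])
qed

text \<open>The convergence hypothesis of the converse speaks of runs of the method; to use it at an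
  arbitrary point of the band, a run starting there must exist. It is built by choosing a minimizer
  at every step.\<close>

lemma vbpg_exists:
  assumes "L \<le> m / \<epsilon>u"
  obtains y where "vbpg (\<lambda>u. ereal (f u)) g K \<epsilon> y" and "y 0 = x"
proof
  let ?T = "\<lambda>k. prox_map (\<lambda>u. ereal (f u)) g (bregman (K k)) (\<epsilon> k)"
  let ?y = "rec_nat x (\<lambda>k u. SOME z. z \<in> ?T k u)"
  have "?T k u \<noteq> {}" for k u
    using step.T_nonempty[OF g_lsc F_bounded] order_trans[OF assms m_div_\<epsilon>] by blast
  then show "vbpg (\<lambda>u. ereal (f u)) g K \<epsilon> ?y"
    by (simp add: vbpg_def some_in_eq)
qed simp

section \<open>From the linear rate to the two error bounds\<close>

lemma error_bounds:
  fixes \<rho> \<beta> c1 \<nu> :: real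
  defines "c1 \<equiv> \<epsilon>u / ((1 - \<beta>) * (m - \<epsilon>u * \<rho>)) * sqrt (\<epsilon>u / \<epsilon>l)"
  assumes ne: "level_le F Fbar \<noteq> {}"
    and sc: "semi_convex \<rho> g" and \<epsilon>u_less: "\<epsilon>u < min (m / L) (m / \<rho>)"
    and \<beta>: "0 < \<beta>" "\<beta> < 1"
    and conv: "\<And>y. vbpg (\<lambda>u. ereal (f u)) g K \<epsilon> y \<Longrightarrow> y 0 \<in> band F Fbar \<nu>
      \<Longrightarrow> level_linear_conv F Fbar \<beta> y"
  shows "strong_subdiff_EB F Fbar \<nu> c1"
    and "strong_bregman_EB (\<lambda>u. ereal (f u)) g K \<epsilon> Fbar \<nu> (1 + c1 * (L + M / \<epsilon>l))"
proof -
  let ?C = "level_le F Fbar"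
  have \<rho>: "0 < \<rho>"
    using sc by (simp add: semi_convex_def)
  have L_le: "L \<le> m / \<epsilon>u"
    using \<epsilon>u_less L_pos \<epsilon>u_pos by (simp add: field_simps)
  define \<mu> where "\<mu> = m / \<epsilon>u - \<rho>"
  have \<mu>: "0 < \<mu>"
    using \<epsilon>u_less \<rho> \<epsilon>u_pos by (simp add: \<mu>_def field_simps)
  have "m - \<epsilon>u * \<rho> = \<epsilon>u * \<mu>"
    using \<epsilon>u_pos by (simp add: \<mu>_def field_simps)
  then have c1: "c1 = 1 / ((1 - \<beta>) * \<mu>) * sqrt (\<epsilon>u / \<epsilon>l)"
    using \<epsilon>u_pos by (simp add: c1_def)
  \<comment> \<open>The estimate below yields the constant
    \<open>1 / ((1 - \<beta>) * \<mu>)\<close>; since the square root is at least 1,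
    \<open>c1\<close> dominates it.\<close>
  have "1 \<le> \<epsilon>u / \<epsilon>l"
    using \<epsilon>l_pos order_trans[OF \<epsilon>_lower \<epsilon>_upper] by simp
  then have "1 \<le> sqrt (\<epsilon>u / \<epsilon>l)"
    by simp
  then have c1_ge: "1 / ((1 - \<beta>) * \<mu>) \<le> c1"
    using mult_left_mono[of 1 "sqrt (\<epsilon>u / \<epsilon>l)" "1 / ((1 - \<beta>) * \<mu>)"] \<beta> \<mu> by (simp add: c1)
  moreover have "0 < 1 / ((1 - \<beta>) * \<mu>)"
    using \<beta> \<mu> by simp
  ultimately have c1_pos: "0 < c1"
    by linarith
  have bound: "infdist x ?C \<le> c1 * norm \<xi>" if x: "x \<in> band F Fbar \<nu>" and \<xi>: "\<xi> \<in> prox_subdiff F x" for x \<xi>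
  proof -
    obtain y where y: "vbpg (\<lambda>u. ereal (f u)) g K \<epsilon> y" and y0: "y 0 = x"
      using vbpg_exists[OF L_le] .
    have "level_linear_conv F Fbar \<beta> y"
      using conv y x y0 by simp
    then have "infdist (y (Suc 0)) ?C \<le> \<beta> * infdist x ?C"
      unfolding level_linear_conv_def edist_infdist[OF ne] using y0
      by (metis ereal_less_eq(3) times_ereal.simps(1))
    \<comment> \<open>The triangle inequality through the first iterate, with its distance to the
      level set absorbed on the left.\<close>
    then have "(1 - \<beta>) * infdist x ?C \<le> norm (x - y (Suc 0))"
      using infdist_triangle[of x ?C "y (Suc 0)"] by (simp add: dist_norm algebra_simps)
    then have "\<mu> * ((1 - \<beta>) * infdist x ?C) \<le> \<mu> * norm (x - y (Suc 0))"
      using \<mu> by (intro mult_left_mono) auto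
    also have "\<dots> \<le> (m / \<epsilon> 0 - \<rho>) * norm (x - y (Suc 0))"
      using m_div_\<epsilon>[of 0] by (intro mult_right_mono) (auto simp: \<mu>_def)
    also have "\<dots> \<le> norm \<xi>"
      using y y0 by (intro step.T_step_le_subgradient[OF sc g_dom \<xi>]) (auto simp: vbpg_def)
    finally have "infdist x ?C \<le> 1 / ((1 - \<beta>) * \<mu>) * norm \<xi>"
      using \<beta> \<mu> by (simp add: field_simps)
    also have "\<dots> \<le> c1 * norm \<xi>"
      using c1_ge by (intro mult_right_mono) auto
    finally show ?thesis .
  qed
  then show "strong_subdiff_EB F Fbar \<nu> c1"
    using c1_pos by (auto simp: strong_subdiff_EB_def edist_infdist[OF ne] intro!: le_mult_edist)
  define \<theta> where "\<theta> = 1 + c1 * (L + M / \<epsilon>l)"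
  have "0 \<le> c1 * (L + M / \<epsilon>l)"
    using c1_pos L_pos M_nonneg \<epsilon>l_pos by simp
  then have \<theta>: "1 \<le> \<theta>"
    by (simp add: \<theta>_def)
  have "infdist x ?C \<le> \<theta> * norm (x - z)"
    if x: "x \<in> band F Fbar \<nu>"
      and z: "z \<in> prox_map (\<lambda>u. ereal (f u)) g (bregman (K k)) (\<epsilon> k) x" for k x z
  proof -
    \<comment> \<open>Either \<open>z\<close> has reached the level set, or descent keeps it in the
      band, where \<open>bound\<close> applies to the residual. The summand 1 of
      \<open>\<theta>\<close> is the cost of passing from \<open>z\<close> back to
      \<open>x\<close>.\<close>
    have "infdist z ?C \<le> c1 * (L + M / \<epsilon>l) * norm (x - z)"
    proof (cases "F z \<le> Fbar")
      case True
      then have "infdist z ?C = 0"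
        by (simp add: level_le_def)
      then show ?thesis
        using \<open>0 \<le> c1 * (L + M / \<epsilon>l)\<close> by simp
    next
      case False
      have "F z \<le> F x"
        using step.T_descent[OF z] order_trans[OF L_le m_div_\<epsilon>] by simp
      then have "z \<in> band F Fbar \<nu>"
        using x False by (auto simp: band_def)
      then have "infdist z ?C \<le> c1 * norm (step.residual k x z)"
        using bound step.residual_subdiff[OF z L_pos] by blast
      also have "\<dots> \<le> c1 * ((L + M / \<epsilon> k) * norm (x - z))"
        using c1_pos step.norm_residual by (intro mult_left_mono) auto
      also have "\<dots> \<le> c1 * ((L + M / \<epsilon>l) * norm (x - z))"
        using c1_pos M_div_\<epsilon>[of k] by (intro mult_left_mono mult_right_mono) auto
      finally show ?thesis
        by (simp add: mult.assoc)
    qed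
    then show ?thesis
      using infdist_triangle[of x ?C z] by (simp add: \<theta>_def dist_norm algebra_simps)
  qed
  then show "strong_bregman_EB (\<lambda>u. ereal (f u)) g K \<epsilon> Fbar \<nu> (1 + c1 * (L + M / \<epsilon>l))"
    using \<theta> unfolding \<theta>_def[symmetric]
    by (auto simp: strong_bregman_EB_def edist_infdist[OF ne] intro!: le_mult_edist)
qed

end

section \<open>Reduction of the theorem to a real-valued \<open>f\<close>\<close>

theorem theorem4p1:
  fixes f g :: "real^'n \<Rightarrow> ereal"
    and K :: "nat \<Rightarrow> real^'n \<Rightarrow> real"
    and \<epsilon> :: "nat \<Rightarrow> real"
    and L m M \<epsilon>l \<epsilon>u \<nu> \<bb> \<cc> :: real
    and x :: "nat \<Rightarrow> real^'n" and xbar :: "real^'n" and Fbar :: ereal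
  assumes "assumption1 f g L"
    and "effdom f = UNIV"
    and "assumption2 K \<epsilon> m M \<epsilon>l \<epsilon>u"
    and "vbpg f g K \<epsilon> x"
    and "accumulation_point x xbar"
    and "Fbar = objective f g xbar"
    and "\<nu> > 0"
    and "\<bb> = M / \<epsilon>l + 2 + 3 * L"
    and "\<cc> = m / \<epsilon>u - (L + 2)"
  shows
    "(\<forall>y \<theta> \<beta>.
        vbpg f g K \<epsilon> y \<and> y 0 \<in> band (objective f g) Fbar \<nu> \<and>
        strong_bregman_EB f g K \<epsilon> Fbar \<nu> \<theta> \<and>
        \<theta> \<in> {sqrt (\<cc> / \<bb>) <..< sqrt (\<cc> / (\<bb> - 1))} \<and>
        \<beta> = sqrt (\<bb> - \<cc> / \<theta>\<^sup>2)
        \<longrightarrow> 0 < \<beta> \<and> \<beta> < 1 \<and> level_linear_conv (objective f g) Fbar \<beta> y)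
     \<and>
     (\<forall>\<rho> \<beta> c1.
        semi_convex \<rho> g \<and> \<epsilon>u < min (m / L) (m / \<rho>) \<and> 0 < \<beta> \<and> \<beta> < 1 \<and>
        (\<forall>y. vbpg f g K \<epsilon> y \<and> y 0 \<in> band (objective f g) Fbar \<nu>
             \<longrightarrow> level_linear_conv (objective f g) Fbar \<beta> y) \<and>
        c1 = \<epsilon>u / ((1 - \<beta>) * (m - \<epsilon>u * \<rho>)) * sqrt (\<epsilon>u / \<epsilon>l)
        \<longrightarrow> strong_subdiff_EB (objective f g) Fbar \<nu> c1 \<and>
            strong_bregman_EB f g K \<epsilon> Fbar \<nu> (1 + c1 * (L + M / \<epsilon>l)))"
proof -
  define h where "h = (\<lambda>u. real_of_ereal (f u))"
  have A: "proper_fun f" "h differentiable_on UNIV" "L-lipschitz_on UNIV (grad h)"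
    and rest: "0 < L" "proper_fun g" "lsc g" "convex (effdom g)" "level_bounded (objective f g)"
    using assms(1,2) by (auto simp: assumption1_def h_def)
  have f: "f = (\<lambda>u. ereal (h u))"
  proof
    fix u
    have "f u \<noteq> -\<infinity>" "f u < \<infinity>"
      using A(1) assms(2) by (auto simp: proper_fun_def effdom_def)
    then show "f u = ereal (h u)"
      by (cases "f u") (auto simp: h_def)
  qed
  interpret vbpg_setting h g K \<epsilon> L m M \<epsilon>l \<epsilon>u
    using A rest assms(3) by unfold_locales (auto simp: f assumption2_def)
  \<comment> \<open>\<open>xbar\<close> itself lies in the level set, so distances to it are finite
    and \<open>edist\<close> agrees with \<open>infdist\<close>.\<close>
  have ne: "level_le F Fbar \<noteq> {}"
    using assms(6) by (auto simp: level_le_def f)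
  show ?thesis
    unfolding f assms(8,9)
    using linear_convergence[OF ne] error_bounds[OF ne] by auto
qed

end
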